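(* Let $\mathcal{K}\subset\mathcal{N}$ be the two-dimensional manifold of Markov invariant probabilities on $\{0,1\}^{\mathbb N}$. For every point $\mu\in\mathcal{K}$, the sectional curvature for the (orthonormal) pair of tangent vectors to $\mathcal{K}$ at $\mu$ is zero, that is, $K(\hat a_\emptyset^0,\hat a_\emptyset^1)=0$.
   Context: Let $r,s\in(0,1)$, $P=\begin{pmatrix}P_{0,0}&P_{0,1}\\P_{1,0}&P_{1,1}\end{pmatrix}=\begin{pmatrix}r&1-r\\1-s&s\end{pmatrix}$, and let $\pi=(\pi_0,\pi_1)$ be the probability vector with $\pi P=\pi$. On $\{0,1\}^{\mathbb N}$ let $\mu$ be the Markov probability $\mu[x_1,\dots,x_n]=\pi_{x_1}P_{x_1,x_2}\cdots P_{x_{n-1},x_n}$. $\mathcal{K}$ is the set of all such $\mu$, parametrized by $(r,s)\in(0,1)^2$. The Ruelle operator is $\mathscr{L}_{\log J}\varphi(x_1,x_2,\dots)=\sum_{i=0,1}\frac{\pi_iP_{i,x_1}}{\pi_{x_1}}\varphi(i,x_1,x_2,\dots)$. $\mathcal{N}$ is the manifold of Hölder equilibrium probabilities on $\{0,1\}^{\mathbb N}$, with tangent space at $\mu$ the kernel of $\mathscr{L}_{\log J}$ and metric $\langle X,Y\rangle=\int XY\,d\mu$. The tangent vectors to $\mathcal{K}$ at $\mu$ are the functions depending on the two coordinates $(x_1,x_2)$ that lie in the kernel of $\mathscr{L}_{\log J}$; this space has orthonormal basis $\hat a_\emptyset^0=V_1/|V_1|$, $\hat a_\emptyset^1=V_2/|V_2|$,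 where $V_1=\pi_1P_{1,0}1_{[00]}-\pi_0P_{0,0}1_{[10]}$, $V_2=\pi_0P_{0,1}1_{[11]}-\pi_1P_{1,1}1_{[01]}$ and $|\cdot|$ is the $L^2(\mu)$ norm. For a finite word $x=(x_1,\dots,x_n)$, $n\ge1$, $[x]$ is its cylinder and $$e_{[x]}=\tfrac{1}{\sqrt{\mu([x])}}\Big(\sqrt{\tfrac{P_{x_n,1}}{P_{x_n,0}}}\,1_{[x0]}-\sqrt{\tfrac{P_{x_n,0}}{P_{x_n,1}}}\,1_{[x1]}\Big),\quad a_x=\sqrt{\tfrac{\pi_{x_1}}{\pi_0P_{0,x_1}}}\,e_{[0x]}-\sqrt{\tfrac{\pi_{x_1}}{\pi_1P_{1,x_1}}}\,e_{[1x]},\quad \hat a_x=\frac{a_x}{|a_x|}.$$ $\mathcal{F}$ is the family of all $\hat a_x$ ($x$ a finite word of length $\ge1$) together with $\hat a_\emptyset^0,\hat a_\emptyset^1$; it is an orthonormal basis of the kernel of $\mathscr{L}_{\log J}$. $K$ denotes the sectional curvature of $\mathcal{N}$ at $\mu$. For distinct $X,Y\in\mathcal F$ it is expressed through the orthonormal basis $\mathcal F$ by $K(X,Y)=\frac14\big[\sum_{Z\in\mathcal F}(\int XYZ\,d\mu)^2-\sum_{Z\in\mathcal F}\int X^2Z\,d\mu\int Y^2Z\,d\mu\big]$, and this expression is what is meant by $K$ here. *)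

theory Defs
  imports "HOL-Probability.Probability"
begin

(* The alphabet {0,1} is bool, with False = 0 and True = 1.  A point (x_1, x_2, ...) of
   {0,1}^N is a function w :: nat \<Rightarrow> bool, with x_k = w (k - 1). *)

definition trans_prob :: "real \<Rightarrow> real \<Rightarrow> bool \<Rightarrow> bool \<Rightarrow> real" where
  "trans_prob r s i j =
     (if i then (if j then s else 1 - s) else (if j then 1 - r else r))"

definition is_stationary :: "real \<Rightarrow> real \<Rightarrow> (bool \<Rightarrow> real) \<Rightarrow> bool" where
  "is_stationary r s p \<longleftrightarrow>
     (\<forall>i. 0 \<le> p i) \<and> (\<Sum>i\<in>UNIV. p i) = 1 \<and> (\<forall>j. (\<Sum>i\<in>UNIV. p i * trans_prob r s i j) = p j)"

(* The definite description is justified by ex1_stationary below. *)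
definition stat :: "real \<Rightarrow> real \<Rightarrow> bool \<Rightarrow> real" where
  "stat r s = (THE p. is_stationary r s p)"

definition cyl :: "bool list \<Rightarrow> (nat \<Rightarrow> bool) set" where
  "cyl x = {w. \<forall>i<length x. w i = x ! i}"

definition markov_probability :: "real \<Rightarrow> real \<Rightarrow> (nat \<Rightarrow> bool) measure \<Rightarrow> bool" where
  "markov_probability r s \<mu> \<longleftrightarrow>
     prob_space \<mu> \<and> sets \<mu> = sets (PiM UNIV (\<lambda>_. count_space UNIV)) \<and>
     (\<forall>x. x \<noteq> [] \<longrightarrow> measure \<mu> (cyl x) =
        stat r s (hd x) * (\<Prod>i<length x - 1. trans_prob r s (x ! i) (x ! Suc i)))"

(* case_nat i w is the sequence (i, w 0, w 1, ...). *)
definition ruelle :: "real \<Rightarrow> real \<Rightarrow> ((nat \<Rightarrow> bool) \<Rightarrow> real) \<Rightarrow> (nat \<Rightarrow> bool) \<Rightarrow> real" where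
  "ruelle r s \<phi> w =
     (\<Sum>i\<in>UNIV. stat r s i * trans_prob r s i (w 0) / stat r s (w 0) * \<phi> (case_nat i w))"

definition tangent_markov :: "real \<Rightarrow> real \<Rightarrow> ((nat \<Rightarrow> bool) \<Rightarrow> real) set" where
  "tangent_markov r s =
     {\<phi>. (\<exists>f. \<phi> = (\<lambda>w. f (w 0) (w 1))) \<and> ruelle r s \<phi> = (\<lambda>_. 0)}"

definition L2norm :: "(nat \<Rightarrow> bool) measure \<Rightarrow> ((nat \<Rightarrow> bool) \<Rightarrow> real) \<Rightarrow> real" where
  "L2norm \<mu> f = sqrt (\<integral>w. (f w)\<^sup>2 \<partial>\<mu>)"

definition V1 :: "real \<Rightarrow> real \<Rightarrow> (nat \<Rightarrow> bool) \<Rightarrow> real" where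
  "V1 r s w =
     stat r s True * trans_prob r s True False * indicator (cyl [False, False]) w
     - stat r s False * trans_prob r s False False * indicator (cyl [True, False]) w"

definition V2 :: "real \<Rightarrow> real \<Rightarrow> (nat \<Rightarrow> bool) \<Rightarrow> real" where
  "V2 r s w =
     stat r s False * trans_prob r s False True * indicator (cyl [True, True]) w
     - stat r s True * trans_prob r s True True * indicator (cyl [False, True]) w"

definition a0_hat :: "real \<Rightarrow> real \<Rightarrow> (nat \<Rightarrow> bool) measure \<Rightarrow> (nat \<Rightarrow> bool) \<Rightarrow> real" where
  "a0_hat r s \<mu> w = V1 r s w / L2norm \<mu> (V1 r s)"

definition a1_hat :: "real \<Rightarrow> real \<Rightarrow> (nat \<Rightarrow> bool) measure \<Rightarrow> (nat \<Rightarrow> bool) \<Rightarrow> real" where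
  "a1_hat r s \<mu> w = V2 r s w / L2norm \<mu> (V2 r s)"

definition e_cyl :: "real \<Rightarrow> real \<Rightarrow> (nat \<Rightarrow> bool) measure \<Rightarrow> bool list \<Rightarrow> (nat \<Rightarrow> bool) \<Rightarrow> real" where
  "e_cyl r s \<mu> x w = 1 / sqrt (measure \<mu> (cyl x)) *
     (sqrt (trans_prob r s (last x) True / trans_prob r s (last x) False) * indicator (cyl (x @ [False])) w
      - sqrt (trans_prob r s (last x) False / trans_prob r s (last x) True) * indicator (cyl (x @ [True])) w)"

definition a_word :: "real \<Rightarrow> real \<Rightarrow> (nat \<Rightarrow> bool) measure \<Rightarrow> bool list \<Rightarrow> (nat \<Rightarrow> bool) \<Rightarrow> real" where
  "a_word r s \<mu> x w =
     sqrt (stat r s (hd x) / (stat r s False * trans_prob r s False (hd x))) * e_cyl r s \<mu> (False # x) w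
     - sqrt (stat r s (hd x) / (stat r s True * trans_prob r s True (hd x))) * e_cyl r s \<mu> (True # x) w"

definition a_hat :: "real \<Rightarrow> real \<Rightarrow> (nat \<Rightarrow> bool) measure \<Rightarrow> bool list \<Rightarrow> (nat \<Rightarrow> bool) \<Rightarrow> real" where
  "a_hat r s \<mu> x w = a_word r s \<mu> x w / L2norm \<mu> (a_word r s \<mu> x)"

definition basis_family :: "real \<Rightarrow> real \<Rightarrow> (nat \<Rightarrow> bool) measure \<Rightarrow> ((nat \<Rightarrow> bool) \<Rightarrow> real) set" where
  "basis_family r s \<mu> = {a0_hat r s \<mu>, a1_hat r s \<mu>} \<union> a_hat r s \<mu> ` {x. x \<noteq> []}"

(* The expression of the sectional curvature of the manifold of Hoelder equilibrium
   probabilities in the orthonormal basis basis_family, for distinct X, Y in that family.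
   It is meaningful only if both series converge: infsum is 0 otherwise. *)
definition sectional_curvature ::
  "real \<Rightarrow> real \<Rightarrow> (nat \<Rightarrow> bool) measure \<Rightarrow> ((nat \<Rightarrow> bool) \<Rightarrow> real) \<Rightarrow> ((nat \<Rightarrow> bool) \<Rightarrow> real) \<Rightarrow> real" where
  "sectional_curvature r s \<mu> X Y = 1 / 4 *
     ((\<Sum>\<^sub>\<infinity>Z\<in>basis_family r s \<mu>. (\<integral>w. X w * Y w * Z w \<partial>\<mu>)\<^sup>2)
      - (\<Sum>\<^sub>\<infinity>Z\<in>basis_family r s \<mu>. (\<integral>w. (X w)\<^sup>2 * Z w \<partial>\<mu>) * (\<integral>w. (Y w)\<^sup>2 * Z w \<partial>\<mu>)))"


lemma is_stationary_iff:
  assumes "0 < r" "r < 1" "0 < s" "s < 1"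
  shows "is_stationary r s p \<longleftrightarrow> p = (\<lambda>i. if i then (1 - r) / (2 - r - s) else (1 - s) / (2 - r - s))"
    (is "_ \<longleftrightarrow> p = ?q")
proof
  assume "is_stationary r s p"
  then have a: "p False + p True = 1" "p False * (1 - r) + p True * s = p True"
    by (auto simp: is_stationary_def trans_prob_def UNIV_bool dest: spec[of _ True])
  have f: "p False = 1 - p True"
    using a(1) by simp
  have "p True * (2 - r - s) = 1 - r"
    using a(2) unfolding f by (simp add: algebra_simps)
  then have t: "p True = (1 - r) / (2 - r - s)"
    using assms by (simp add: field_simps)
  have "p False = (1 - s) / (2 - r - s)"
    unfolding f t using assms by (simp add: field_simps)
  with t show "p = ?q"
    by (intro ext) auto
next
  assume "p = ?q"
  then show "is_stationary r s p"
    using assms by (simp add: is_stationary_def trans_prob_def UNIV_bool add_divide_distrib[symmetric])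
      (simp add: algebra_simps)
qed

lemma ex1_stationary:
  assumes "0 < r" "r < 1" "0 < s" "s < 1"
  shows "\<exists>!p. is_stationary r s p"
  using is_stationary_iff[OF assms] by auto

lemma stat_eq:
  assumes "0 < r" "r < 1" "0 < s" "s < 1"
  shows "stat r s = (\<lambda>i. if i then (1 - r) / (2 - r - s) else (1 - s) / (2 - r - s))"
  unfolding stat_def is_stationary_iff[OF assms] by simp

lemma is_stationary_stat:
  assumes "0 < r" "r < 1" "0 < s" "s < 1"
  shows "is_stationary r s (stat r s)"
  using is_stationary_iff[OF assms] stat_eq[OF assms] by blast

lemma stat_pos:
  assumes "0 < r" "r < 1" "0 < s" "s < 1"
  shows "0 < stat r s i"
  using assms by (simp add: stat_eq)

lemma trans_prob_pos:
  assumes "0 < r" "r < 1" "0 < s" "s < 1"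
  shows "0 < trans_prob r s i j"
  using assms by (simp add: trans_prob_def)

lemma cyl_two: "w \<in> cyl [a, b] \<longleftrightarrow> w 0 = a \<and> w 1 = b"
  by (auto simp: cyl_def less_Suc_eq)

lemma a_hats_tangent:
  assumes "0 < r" "r < 1" "0 < s" "s < 1"
  shows "a0_hat r s \<mu> \<in> tangent_markov r s" "a1_hat r s \<mu> \<in> tangent_markov r s"
proof -
  note [simp] = stat_pos[OF assms, THEN less_imp_neq, symmetric]
  have "\<exists>f. a0_hat r s \<mu> = (\<lambda>w. f (w 0) (w 1))"
    by (rule exI[of _ "\<lambda>i j. (stat r s True * trans_prob r s True False * of_bool (\<not> i \<and> \<not> j)
      - stat r s False * trans_prob r s False False * of_bool (i \<and> \<not> j)) / L2norm \<mu> (V1 r s)"])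
      (auto simp: a0_hat_def V1_def cyl_two indicator_def fun_eq_iff)
  moreover have "ruelle r s (a0_hat r s \<mu>) = (\<lambda>_. 0)"
    by (auto simp: fun_eq_iff ruelle_def a0_hat_def V1_def cyl_two indicator_def UNIV_bool
        intro: ccontr split: if_splits)
  ultimately show "a0_hat r s \<mu> \<in> tangent_markov r s"
    unfolding tangent_markov_def by blast
  have "\<exists>f. a1_hat r s \<mu> = (\<lambda>w. f (w 0) (w 1))"
    by (rule exI[of _ "\<lambda>i j. (stat r s False * trans_prob r s False True * of_bool (i \<and> j)
      - stat r s True * trans_prob r s True True * of_bool (\<not> i \<and> j)) / L2norm \<mu> (V2 r s)"])
      (auto simp: a1_hat_def V2_def cyl_two indicator_def fun_eq_iff)
  moreover have "ruelle r s (a1_hat r s \<mu>) = (\<lambda>_. 0)"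
    by (auto simp: fun_eq_iff ruelle_def a1_hat_def V2_def cyl_two indicator_def UNIV_bool)
  ultimately show "a1_hat r s \<mu> \<in> tangent_markov r s"
    unfolding tangent_markov_def by blast
qed

lemma cyl_sets: "cyl x \<in> sets (PiM UNIV (\<lambda>_. count_space UNIV))"
proof -
  have *: "cyl x = {w \<in> space (PiM UNIV (\<lambda>_. count_space UNIV)). \<forall>i\<in>{..<length x}. w i = x ! i}"
    by (auto simp: cyl_def space_PiM)
  have [measurable]: "(\<lambda>w. w i) \<in> measurable (PiM UNIV (\<lambda>_. count_space UNIV)) (count_space (UNIV :: bool set))" for i :: nat
    by (rule measurable_component_singleton) simp
  show ?thesis
    unfolding * by measurable
qed

lemma a_hats_orthonormal:
  assumes rs: "0 < r" "r < 1" "0 < s" "s < 1" and mu: "markov_probability r s \<mu>"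
  shows "(\<integral>w. (a0_hat r s \<mu> w)\<^sup>2 \<partial>\<mu>) = 1" "(\<integral>w. (a1_hat r s \<mu> w)\<^sup>2 \<partial>\<mu>) = 1"
    "(\<integral>w. a0_hat r s \<mu> w * a1_hat r s \<mu> w \<partial>\<mu>) = 0"
proof -
  interpret prob_space \<mu>
    using mu by (simp add: markov_probability_def)
  have c[measurable]: "cyl x \<in> sets \<mu>" for x
    using cyl_sets mu by (simp add: markov_probability_def)
  have m: "measure \<mu> (cyl [i, j]) = stat r s i * trans_prob r s i j" for i j
    using mu by (simp add: markov_probability_def)
  have p: "0 < stat r s i * trans_prob r s i j" for i j
    using stat_pos[OF rs] trans_prob_pos[OF rs] by simp
  have i: "(\<integral>w. u\<^sup>2 * indicator (cyl x) w + v\<^sup>2 * indicator (cyl y) w \<partial>\<mu>)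
      = u\<^sup>2 * measure \<mu> (cyl x) + v\<^sup>2 * measure \<mu> (cyl y)" for u v :: real and x y
    by (subst Bochner_Integration.integral_add)
      (auto intro!: integrable_mult_right integrable_real_indicator emeasure_finite simp: less_top[symmetric])
  have "(V1 r s w)\<^sup>2 = (stat r s True * trans_prob r s True False)\<^sup>2 * indicator (cyl [False, False]) w
      + (stat r s False * trans_prob r s False False)\<^sup>2 * indicator (cyl [True, False]) w" for w
    by (auto simp: V1_def cyl_two indicator_def)
  then have n1: "(\<integral>w. (V1 r s w)\<^sup>2 \<partial>\<mu>) > 0"
    by (simp only: i m) (intro add_pos_pos mult_pos_pos[OF zero_less_power] p)
  have "(V2 r s w)\<^sup>2 = (stat r s False * trans_prob r s False True)\<^sup>2 * indicator (cyl [True, True]) w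
      + (stat r s True * trans_prob r s True True)\<^sup>2 * indicator (cyl [False, True]) w" for w
    by (auto simp: V2_def cyl_two indicator_def)
  then have n2: "(\<integral>w. (V2 r s w)\<^sup>2 \<partial>\<mu>) > 0"
    by (simp only: i m) (intro add_pos_pos mult_pos_pos[OF zero_less_power] p)
  show "(\<integral>w. (a0_hat r s \<mu> w)\<^sup>2 \<partial>\<mu>) = 1"
    using n1 by (simp add: a0_hat_def power_divide L2norm_def)
  show "(\<integral>w. (a1_hat r s \<mu> w)\<^sup>2 \<partial>\<mu>) = 1"
    using n2 by (simp add: a1_hat_def power_divide L2norm_def)
  have "a0_hat r s \<mu> w * a1_hat r s \<mu> w = 0" for w
    by (auto simp: a0_hat_def a1_hat_def V1_def V2_def cyl_two indicator_def)
  then show "(\<integral>w. a0_hat r s \<mu> w * a1_hat r s \<mu> w \<partial>\<mu>) = 0"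
    by (simp only: integral_zero)
qed

(* markov_probability r s is satisfiable: the measure is obtained from the kernels below by
   the Ionescu-Tulcea theorem. *)
definition init_pmf :: "real \<Rightarrow> real \<Rightarrow> bool pmf" where
  "init_pmf r s = bernoulli_pmf (stat r s True)"

definition step_pmf :: "real \<Rightarrow> real \<Rightarrow> bool \<Rightarrow> bool pmf" where
  "step_pmf r s i = bernoulli_pmf (trans_prob r s i True)"

lemma pmf_init:
  assumes "0 < r" "r < 1" "0 < s" "s < 1"
  shows "pmf (init_pmf r s) j = stat r s j"
  using is_stationary_stat[OF assms] stat_pos[OF assms, of True] stat_pos[OF assms, of False]
  by (cases j) (simp_all add: init_pmf_def is_stationary_def UNIV_bool)

lemma pmf_step:
  assumes "0 < r" "r < 1" "0 < s" "s < 1"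
  shows "pmf (step_pmf r s i) j = trans_prob r s i j"
  using assms by (cases j) (simp_all add: step_pmf_def trans_prob_def)

lemma ex_markov_probability:
  assumes rs: "0 < r" "r < 1" "0 < s" "s < 1"
  shows "\<exists>\<mu>. markov_probability r s \<mu>"
proof -
  define K :: "nat \<Rightarrow> (nat \<Rightarrow> bool) \<Rightarrow> bool measure" where
    "K n w = measure_pmf (if n = 0 then init_pmf r s else step_pmf r s (w (n - 1)))" for n w
  let ?M = "\<lambda>_::nat. count_space (UNIV :: bool set)"
  interpret IT: Ionescu_Tulcea K ?M
  proof (rule Ionescu_Tulcea.intro, goal_cases)
    case (1 n)
    show ?case
    proof (cases n)
      case 0
      then show ?thesis
        by (simp add: K_def[abs_def] space_subprob_algebra prob_space_imp_subprob_space
             measure_pmf.prob_space_axioms)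
    next
      case (Suc m)
      have 1: "(\<lambda>w. w m) \<in> measurable (PiM {0..<n} ?M) (count_space UNIV)"
        by (rule measurable_component_singleton) (simp add: Suc)
      have 2: "(\<lambda>i. measure_pmf (step_pmf r s i)) \<in> measurable (count_space UNIV) (subprob_algebra (count_space UNIV))"
        by (simp add: space_subprob_algebra prob_space_imp_subprob_space
             measure_pmf.prob_space_axioms)
      show ?thesis
        using measurable_compose[OF 1 2] by (simp add: K_def[abs_def] Suc)
    qed
  next
    case (2 n w)
    show ?case
      by (simp add: K_def measure_pmf.prob_space_axioms)
  qed
  define S where "S x = {restrict (\<lambda>i. x ! i) {0..<length x}}" for x :: "bool list"
  have S_PiE: "S x = PiE {0..<length x} (\<lambda>i. {x ! i})" for x
  proof -
    have "PiE {0..<length x} (\<lambda>i. {x ! i}) = PiE {0..<length x} (\<lambda>i. {restrict (\<lambda>i. x ! i) {0..<length x} i})"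
      by (intro PiE_cong) simp
    also have "\<dots> = S x"
      unfolding S_def by (intro PiE_singleton restrict_extensional)
    finally show ?thesis ..
  qed
  have Sm: "S x \<in> sets (PiM {0..<length x} ?M)" for x
    unfolding S_PiE by (rule sets_PiM_I_finite) auto
  have C: "emeasure (IT.C 0 (length x) (\<lambda>_. undefined)) (S x) =
      (if x = [] then 1 else ennreal (stat r s (hd x) * (\<Prod>i<length x - 1. trans_prob r s (x ! i) (x ! Suc i))))" for x
  proof (induction x rule: rev_induct)
    case Nil
    then show ?case
      using Sm[of "[]"] by (simp add: S_def restrict_def)
  next
    case (snoc b x)
    let ?n = "length x" and ?u = "\<lambda>_. undefined"
    let ?D = "IT.C 0 ?n ?u"
    have u: "?u \<in> space (PiM {0..<0} ?M)"
      by (simp add: space_PiM)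
    have sD: "space ?D = space (PiM {0..<?n} ?M)"
      using IT.space_C[OF u, of ?n] by simp
    have setsD: "sets ?D = sets (PiM {0..<?n} ?M)"
      using IT.sets_C[OF u, of ?n] by simp
    have Sb: "S (x @ [b]) \<in> sets (PiM {0..<Suc ?n} ?M)"
      using Sm[of "x @ [b]"] by simp
    have ne: "space ?D \<noteq> {}"
      by (simp add: sD space_PiM PiE_eq_empty_iff)
    have eP: "IT.eP ?n \<in> measurable ?D (subprob_algebra (PiM {0..<Suc ?n} ?M))"
      using IT.measurable_eP[of ?n] by (simp cong: measurable_cong_sets add: setsD measurable_cong_sets[OF setsD refl])
    let ?c = "ennreal (if x = [] then stat r s b else trans_prob r s (last x) b)"
    have pt: "emeasure (IT.eP ?n w) (S (x @ [b])) = ?c * indicator (S x) w"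
      if w: "w \<in> space (PiM {0..<?n} ?M)" for w
    proof -
      have "(w(?n := y) \<in> S (x @ [b])) \<longleftrightarrow> w \<in> S x \<and> y = b" for y
      proof -
        have ext: "w \<in> extensional {0..<?n}"
          using w by (auto simp: space_PiM PiE_def)
        show ?thesis
          using ext unfolding S_PiE
          by (auto simp: PiE_iff extensional_def nth_append less_Suc_eq)
      qed
      then have v: "(\<lambda>y. w(?n := y)) -` S (x @ [b]) = (if w \<in> S x then {b} else {})"
        by auto
      have l: "w (?n - 1) = last x" if "w \<in> S x" "x \<noteq> []"
        using that by (simp add: S_def last_conv_nth)
      show ?thesis
        using l by (subst IT.emeasure_eP[OF w Sb])
          (auto simp: v K_def emeasure_pmf_single pmf_init[OF rs] pmf_step[OF rs])
    qed
    have "emeasure (IT.C 0 (length (x @ [b])) ?u) (S (x @ [b])) = (\<integral>\<^sup>+w. emeasure (IT.eP ?n w) (S (x @ [b])) \<partial>?D)"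
      by (simp add: emeasure_bind[OF ne eP Sb])
    also have "\<dots> = (\<integral>\<^sup>+w. ?c * indicator (S x) w \<partial>?D)"
      by (intro nn_integral_cong) (simp add: pt sD)
    also have "\<dots> = ?c * emeasure ?D (S x)"
      by (rule nn_integral_cmult_indicator) (simp add: setsD Sm)
    also have "\<dots> = ennreal (stat r s (hd (x @ [b])) *
        (\<Prod>i<length (x @ [b]) - 1. trans_prob r s ((x @ [b]) ! i) ((x @ [b]) ! Suc i)))"
    proof (cases "x = []")
      case False
      then obtain k where k: "?n = Suc k"
        by (cases x) auto
      have "(\<Prod>i<k. trans_prob r s ((x @ [b]) ! i) ((x @ [b]) ! Suc i)) = (\<Prod>i<k. trans_prob r s (x ! i) (x ! Suc i))"
        by (intro prod.cong) (auto simp: nth_append k)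
      then have e: "trans_prob r s (last x) b * (stat r s (hd x) * (\<Prod>i<?n - 1. trans_prob r s (x ! i) (x ! Suc i)))
          = stat r s (hd (x @ [b])) *
            (\<Prod>i<length (x @ [b]) - 1. trans_prob r s ((x @ [b]) ! i) ((x @ [b]) ! Suc i))"
        using False k by (simp add: nth_append last_conv_nth mult_ac)
      show ?thesis
        unfolding snoc.IH e[symmetric]
        using False trans_prob_pos[OF rs, THEN less_imp_le] by (simp only: if_False ennreal_mult')
    next
      case True
      then show ?thesis
        unfolding snoc.IH by simp
    qed
    finally show ?case
      by simp
  qed
  have cyl: "cyl x = IT.PF.emb UNIV {0..<length x} (S x)" for x
    unfolding S_PiE set_eq_iff by (simp add: cyl_def prod_emb_iff PiE_iff Ball_def)
  have L: "emeasure IT.PF.lim (cyl x) =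
      (if x = [] then 1 else ennreal (stat r s (hd x) * (\<Prod>i<length x - 1. trans_prob r s (x ! i) (x ! Suc i))))" for x
  proof -
    have "emeasure IT.PF.lim (cyl x) = emeasure (IT.CI {0..<length x}) (S x)"
      unfolding cyl by (rule IT.lim[OF finite_atLeastLessThan Sm])
    also have "\<dots> = emeasure (IT.C 0 (length x) (\<lambda>_. undefined)) (IT.PF.emb {0..<length x} {0..<length x} (S x))"
      by (rule IT.emeasure_CI[OF subset_refl Sm])
    also have "IT.PF.emb {0..<length x} {0..<length x} (S x) = S x"
      by (rule prod_emb_id) (simp add: S_def PiE_iff restrict_extensional)
    finally show ?thesis
      unfolding C .
  qed
  have "markov_probability r s IT.PF.lim"
    unfolding markov_probability_def
  proof (intro conjI allI impI)
    show "prob_space IT.PF.lim"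
    proof
      have "cyl [] = space IT.PF.lim"
        by (simp add: cyl_def space_PiM)
      then show "emeasure IT.PF.lim (space IT.PF.lim) = 1"
        using L[of "[]"] by simp
    qed
    show "sets IT.PF.lim = sets (PiM UNIV ?M)"
      by (rule IT.PF.sets_lim)
  next
    fix x :: "bool list" assume x: "x \<noteq> []"
    have "0 \<le> stat r s (hd x) * (\<Prod>i<length x - 1. trans_prob r s (x ! i) (x ! Suc i))"
      using stat_pos[OF rs] trans_prob_pos[OF rs] by (intro mult_nonneg_nonneg prod_nonneg) (auto intro: less_imp_le)
    then show "measure IT.PF.lim (cyl x) =
        stat r s (hd x) * (\<Prod>i<length x - 1. trans_prob r s (x ! i) (x ! Suc i))"
      unfolding measure_def L using x by simp
  qed
  then show ?thesis
    by blast
qed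

end

theory Submission
  imports Defs
begin

text \<open>\<open>V1\<close> and \<open>V2\<close> live on the disjoint events \<open>w 1 = 0\<close> and \<open>w 1 = 1\<close>, so every
  integrand containing the product of the two tangent vectors vanishes. For the remaining
  basis vectors \<open>a_hat x\<close>, each building block \<open>e_cyl (i # x)\<close> is supported in a cylinder
  on which the first two coordinates are constant and has mean zero, so \<open>a_hat x\<close> is orthogonal
  to all functions of these two coordinates, in particular to the square of \<open>a0_hat\<close>. Hence
  both series vanish term by term.\<close>

lemma measure_cyl_append:
  assumes mu: "markov_probability r s \<mu>" and x: "x \<noteq> []"
  shows "measure \<mu> (cyl (x @ [b])) = measure \<mu> (cyl x) * trans_prob r s (last x) b"
proof -
  obtain k where k: "length x = Suc k"
    using x by (cases x) auto
  have "(\<Prod>i<k. trans_prob r s ((x @ [b]) ! i) ((x @ [b]) ! Suc i))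
      = (\<Prod>i<k. trans_prob r s (x ! i) (x ! Suc i))"
    by (intro prod.cong) (auto simp: nth_append k)
  then show ?thesis
    using mu x k by (simp add: markov_probability_def nth_append last_conv_nth)
qed

lemma integrable_indicator_cyl:
  assumes "markov_probability r s \<mu>"
  shows "integrable \<mu> (indicator (cyl x) :: _ \<Rightarrow> real)"
proof -
  interpret prob_space \<mu>
    using assms by (simp add: markov_probability_def)
  have "cyl x \<in> sets \<mu>"
    using cyl_sets assms by (simp add: markov_probability_def)
  then show ?thesis
    by (simp add: integrable_real_indicator less_top[symmetric])
qed

text \<open>Integrals of indicators evaluate to measures of intersections with
  \<open>space \<mu>\<close>; this removes the intersection.\<close>

lemma space_markov_probability:
  assumes "markov_probability r s \<mu>"
  shows "space \<mu> = UNIV"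
proof -
  have "space \<mu> = space (PiM UNIV (\<lambda>_. count_space UNIV) :: (nat \<Rightarrow> bool) measure)"
    using assms by (intro sets_eq_imp_space_eq) (simp add: markov_probability_def)
  then show ?thesis
    by (simp add: space_PiM)
qed

lemma integrable_e_cyl:
  assumes "markov_probability r s \<mu>"
  shows "integrable \<mu> (e_cyl r s \<mu> x)"
  unfolding e_cyl_def[abs_def]
  by (intro integrable_mult_right Bochner_Integration.integrable_diff
      integrable_indicator_cyl[OF assms])

text \<open>The square-root weights are balanced: with p and q the transition probabilities out of
  \<open>last x\<close>, both halves contribute sqrt (p * q) with opposite signs.\<close>

lemma integral_e_cyl:
  assumes rs: "0 < r" "r < 1" "0 < s" "s < 1"
    and mu: "markov_probability r s \<mu>" and x: "x \<noteq> []"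
  shows "(\<integral>w. e_cyl r s \<mu> x w \<partial>\<mu>) = 0"
proof -
  have sqrt_quot: "sqrt (a / b) * b = sqrt (a * b)" if "0 < b" for a b :: real
    using that by (simp add: real_sqrt_divide real_sqrt_mult real_div_sqrt
        flip: times_divide_eq_right)
  note t = trans_prob_pos[OF rs, of "last x"]
  have "sqrt (trans_prob r s (last x) True / trans_prob r s (last x) False)
        * trans_prob r s (last x) False
      = sqrt (trans_prob r s (last x) False / trans_prob r s (last x) True)
        * trans_prob r s (last x) True"
    unfolding sqrt_quot[OF t] by (simp only: mult.commute)
  then show ?thesis
    unfolding e_cyl_def
    by (simp add: Bochner_Integration.integral_diff integrable_indicator_cyl[OF mu]
        space_markov_probability[OF mu] measure_cyl_append[OF mu x])
qed

text \<open>As \<open>x\<close> is nonempty, the word \<open>i # x\<close> fixes both coordinates on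
  the support, so \<open>f\<close> acts there as a constant.\<close>

lemma mult_e_cyl_Cons:
  assumes "x \<noteq> []"
  shows "f (w 0) (w 1) * e_cyl r s \<mu> (i # x) w = f i (hd x) * e_cyl r s \<mu> (i # x) w"
proof -
  have "w 0 = i \<and> w 1 = hd x" if "w \<in> cyl (i # x @ [b])" for b
    using that assms by (auto simp: cyl_def nth_append hd_conv_nth dest: spec[of _ 0] spec[of _ 1])
  then show ?thesis
    by (auto simp: e_cyl_def indicator_def)
qed

lemma integral_mult_a_hat:
  fixes f :: "bool \<Rightarrow> bool \<Rightarrow> real"
  assumes rs: "0 < r" "r < 1" "0 < s" "s < 1"
    and mu: "markov_probability r s \<mu>" and x: "x \<noteq> []"
  shows "(\<integral>w. f (w 0) (w 1) * a_hat r s \<mu> x w \<partial>\<mu>) = 0"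
proof -
  \<comment> \<open>\<open>c\<close> and \<open>d\<close> absorb the square-root coefficients and
    the division by the norm.\<close>
  obtain c d where cd: "a_hat r s \<mu> x w
      = c * e_cyl r s \<mu> (False # x) w - d * e_cyl r s \<mu> (True # x) w" for w
    unfolding a_hat_def a_word_def diff_divide_distrib times_divide_eq_left[symmetric] by blast
  have "f (w 0) (w 1) * a_hat r s \<mu> x w
      = c * (f False (hd x) * e_cyl r s \<mu> (False # x) w)
        - d * (f True (hd x) * e_cyl r s \<mu> (True # x) w)" for w
    unfolding cd mult_e_cyl_Cons[OF x, symmetric] by (simp add: algebra_simps)
  then show ?thesis
    by (simp add: Bochner_Integration.integral_diff integrable_e_cyl[OF mu]
        integral_e_cyl[OF rs mu])
qed

lemma a0_hat_mult_a1_hat: "a0_hat r s \<mu> w * a1_hat r s \<mu> w = 0"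
  by (auto simp: a0_hat_def a1_hat_def V1_def V2_def cyl_two indicator_def)

theorem theorem7p14:
  fixes r s :: real and \<mu> :: "(nat \<Rightarrow> bool) measure"
  assumes "0 < r" "r < 1" "0 < s" "s < 1"
    and "markov_probability r s \<mu>"
  shows "(\<lambda>Z. (\<integral>w. a0_hat r s \<mu> w * a1_hat r s \<mu> w * Z w \<partial>\<mu>)\<^sup>2) summable_on basis_family r s \<mu> \<and>
    (\<lambda>Z. (\<integral>w. (a0_hat r s \<mu> w)\<^sup>2 * Z w \<partial>\<mu>) * (\<integral>w. (a1_hat r s \<mu> w)\<^sup>2 * Z w \<partial>\<mu>))
      summable_on basis_family r s \<mu> \<and>
    sectional_curvature r s \<mu> (a0_hat r s \<mu>) (a1_hat r s \<mu>) = 0"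
proof -
  note rs = assms(1-4) and mu = assms(5)
  obtain f where f: "a0_hat r s \<mu> = (\<lambda>w. f (w 0) (w 1))"
    using a_hats_tangent(1)[OF rs, of \<mu>] by (auto simp: tangent_markov_def)
  have zero: "(\<integral>w. (a0_hat r s \<mu> w)\<^sup>2 * Z w \<partial>\<mu>) * (\<integral>w. (a1_hat r s \<mu> w)\<^sup>2 * Z w \<partial>\<mu>) = 0"
    if Z: "Z \<in> basis_family r s \<mu>" for Z
  proof -
    consider "Z = a0_hat r s \<mu>" | "Z = a1_hat r s \<mu>" | x where "x \<noteq> []" "Z = a_hat r s \<mu> x"
      using Z by (auto simp: basis_family_def)
    then show ?thesis
    proof cases
      case 1
      \<comment> \<open>The integrand contains the vanishing product \<open>a0_hat * a1_hat\<close>,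
        so here the second factor is zero; in the next case it is the first.\<close>
      have *: "(a1_hat r s \<mu> w)\<^sup>2 * a0_hat r s \<mu> w = 0" for w
        using a0_hat_mult_a1_hat[of r s \<mu> w] by auto
      show ?thesis
        by (simp only: 1 * integral_zero mult_zero_right)
    next
      case 2
      have *: "(a0_hat r s \<mu> w)\<^sup>2 * a1_hat r s \<mu> w = 0" for w
        using a0_hat_mult_a1_hat[of r s \<mu> w] by auto
      show ?thesis
        by (simp only: 2 * integral_zero mult_zero_left)
    next
      case 3
      then show ?thesis
        using integral_mult_a_hat[OF rs mu, of x "\<lambda>i j. (f i j)\<^sup>2"] by (simp add: f)
    qed
  qed
  show ?thesis
    \<comment> \<open>Both families are identically zero on the basis, hence summable with sum zero.
      Removing \<open>mult_eq_0_iff\<close> keeps the product in the form of \<open>zero\<close>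
      instead of splitting it into a disjunction.\<close>
    by (auto simp: sectional_curvature_def a0_hat_mult_a1_hat
        simp del: mult_eq_0_iff intro!: summable_on_0 infsum_0 zero)
qed

end
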